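(* Consider an $M/M/1$ queueing system with arrival rate $\lambda$ and service rate $\mu$ satisfying $\lambda>\mu>0$. Then the probability that a busy period ends, i.e. that starting from exactly one customer the number of customers in the system reaches $0$ at some finite time (rather than following a path which never returns to $0$), equals $\dfrac{\mu}{\lambda}$.
   Context: In the $M/M/1$ queueing system with arrival rate $\lambda$ and service rate $\mu$, the number of customers $N(t)$, $t\ge 0$, is the continuous-time Markov chain on $\{0,1,2,\dots\}$ that jumps from $n$ to $n+1$ at rate $\lambda$ for every $n\ge 0$ and from $n$ to $n-1$ at rate $\mu$ for every $n\ge 1$. A busy period begins with a single customer (say $N(0)=1$) and ends at the first time $t>0$ with $N(t)=0$; it never ends if no such $t$ exists. *)

theory Defs
  imports "HOL-Probability.Probability"
begin

text \<open>
  A transition semigroup on a state space: \<open>pmf (p t i) j\<close> is the probability of being in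
  state \<open>j\<close> at time \<open>s + t\<close> given state \<open>i\<close> at time \<open>s\<close>.  Values at negative times are irrelevant.
\<close>

definition transition_semigroup :: "(real \<Rightarrow> 's \<Rightarrow> 's pmf) \<Rightarrow> bool" where
  "transition_semigroup p \<longleftrightarrow>
     (\<forall>i. p 0 i = return_pmf i) \<and>
     (\<forall>s\<ge>0. \<forall>t\<ge>0. \<forall>i. p (s + t) i = bind_pmf (p s i) (p t))"

text \<open>
  Jump rates \<open>q i j\<close> are given for \<open>i \<noteq> j\<close> only; the diagonal of \<open>q\<close> is ignored and the diagonal
  of the generator is minus the total rate of leaving \<open>i\<close>.
\<close>

definition generator :: "('s \<Rightarrow> 's \<Rightarrow> real) \<Rightarrow> 's \<Rightarrow> 's \<Rightarrow> real" where
  "generator q i j = (if i = j then - (\<Sum>\<^sub>\<infinity>k\<in>-{i}. q i k) else q i j)"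

definition has_jump_rates :: "(real \<Rightarrow> 's \<Rightarrow> 's pmf) \<Rightarrow> ('s \<Rightarrow> 's \<Rightarrow> real) \<Rightarrow> bool" where
  "has_jump_rates p q \<longleftrightarrow>
     (\<forall>i. (\<forall>j. j \<noteq> i \<longrightarrow> 0 \<le> q i j) \<and> q i summable_on -{i}) \<and>
     (\<forall>i j. ((\<lambda>t. pmf (p t i) j) has_real_derivative generator q i j) (at 0 within {0..}))"

text \<open>
  Continuous-time Markov chains \<open>X t\<close>, \<open>t \<ge> 0\<close>, with jump rates \<open>q\<close> and an arbitrary initial
  distribution.  The state space is discrete, so right-continuity says that the path stays in its
  current state for a positive amount of time after every instant.
\<close>

locale ctmc = prob_space M
  for M :: "'a measure"
    and X :: "real \<Rightarrow> 'a \<Rightarrow> 's :: {countable, discrete_topology}"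
    and q :: "'s \<Rightarrow> 's \<Rightarrow> real" +
  assumes random_variable: "0 \<le> t \<Longrightarrow> X t \<in> M \<rightarrow>\<^sub>M count_space UNIV"
    and right_continuous:
      "\<omega> \<in> space M \<Longrightarrow> 0 \<le> t \<Longrightarrow> continuous (at_right t) (\<lambda>s. X s \<omega>)"
    and markov:
      "\<exists>p. transition_semigroup p \<and> has_jump_rates p q \<and>
         (\<forall>n (t :: nat \<Rightarrow> real) x.
            0 \<le> t 0 \<and> (\<forall>k\<le>n. t k < t (Suc k)) \<and>
            \<P>(\<omega> in M. \<forall>k\<le>n. X (t k) \<omega> = x k) > 0 \<longrightarrow>
            \<P>(\<omega> in M. X (t (Suc n)) \<omega> = x (Suc n) \<bar> \<forall>k\<le>n. X (t k) \<omega> = x k)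
              = pmf (p (t (Suc n) - t n) (x n)) (x (Suc n)))"

definition mm1_rate :: "real \<Rightarrow> real \<Rightarrow> nat \<Rightarrow> nat \<Rightarrow> real" where
  "mm1_rate lam \<mu> n m = (if m = n + 1 then lam else if n = m + 1 then \<mu> else 0)"

end

theory Submission
  imports Defs "HOL-Real_Asymp.Real_Asymp"
begin

text \<open>
  Observed at the times \<open>k \<delta>\<close> the chain is a discrete-time chain with kernel \<open>p \<delta>\<close>, and by right
  continuity the probability of a visit to \<open>0\<close> is the limit of the corresponding probabilities for
  \<open>\<delta> = 2 ^ -k\<close>.  With \<open>h i = (\<mu> / lam) ^ i\<close> the generator satisfies \<open>Q h \<le> 0\<close>, so \<open>h\<close> is
  superharmonic for every \<open>p \<delta>\<close> and \<open>h 1 = \<mu> / lam\<close> bounds each of these probabilities.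
  Conversely, for \<open>r < \<mu> / lam\<close> the function \<open>r ^ i\<close>, raised by \<open>O(\<delta>)\<close> at \<open>0\<close>, grows in expectation
  by a factor \<open>1 + c \<delta> / 2\<close> with \<open>c > 0\<close> in every step before absorption; since it is bounded, this
  forces the probability of absorption to be at least \<open>r / (1 + O(\<delta>))\<close>.
\<close>

subsection \<open>Absorbed discrete-time chains\<close>

lemma integrable_pmf_bounded:
  fixes f :: "'a \<Rightarrow> real"
  assumes "\<And>x. \<bar>f x\<bar> \<le> B"
  shows "integrable (measure_pmf p) f"
  using assms by (intro measure_pmf.integrable_const_bound[where B = B]) auto

lemma expectation_bind_pmf:
  fixes f :: "'b \<Rightarrow> real"
  assumes "\<And>x. \<bar>f x\<bar> \<le> B"
  shows "measure_pmf.expectation (bind_pmf p k) f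
    = measure_pmf.expectation p (\<lambda>x. measure_pmf.expectation (k x) f)"
  unfolding measure_pmf_bind
  using assms measurable_measure_pmf[of k]
  by (intro integral_bind[where K = "count_space UNIV" and B = B and B' = 1])
    (auto intro: measure_pmf.finite_measure)

lemma abs_expectation_pmf_le:
  fixes f :: "'a \<Rightarrow> real"
  assumes "\<And>x. \<bar>f x\<bar> \<le> B"
  shows "\<bar>measure_pmf.expectation p f\<bar> \<le> B"
proof -
  have "0 \<le> B" using order_trans[OF abs_ge_zero assms] .
  have "\<bar>measure_pmf.expectation p f\<bar> \<le> measure_pmf.expectation p (\<lambda>x. \<bar>f x\<bar>)"
    by (rule integral_abs_bound)
  also have "\<dots> \<le> measure_pmf.expectation p (\<lambda>_. B)"
    using assms \<open>0 \<le> B\<close> by (intro integral_mono integrable_pmf_bounded[where B = B]) auto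
  finally show ?thesis by simp
qed

lemma expectation_pmf_mono:
  fixes f g :: "'a \<Rightarrow> real"
  assumes "\<And>x. \<bar>f x\<bar> \<le> B" "\<And>x. \<bar>g x\<bar> \<le> B'" "\<And>x. f x \<le> g x"
  shows "measure_pmf.expectation p f \<le> measure_pmf.expectation p g"
  using assms by (intro integral_mono integrable_pmf_bounded)

lemma expectation_pmf_ge_single:
  fixes f :: "'a \<Rightarrow> real"
  assumes "\<And>x. 0 \<le> f x" "\<And>x. f x \<le> B"
  shows "pmf p i * f i \<le> measure_pmf.expectation p f"
proof -
  have "pmf p i * f i = measure_pmf.expectation p (\<lambda>x. f i * indicator {i} x)"
    by (simp add: measure_pmf_single)
  also have "\<dots> \<le> measure_pmf.expectation p f"
    using assms order_trans[OF assms]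
    by (intro expectation_pmf_mono[where B = B and B' = B]) (auto simp: indicator_def)
  finally show ?thesis .
qed

text \<open>The chain \<open>K\<close> started at \<open>x\<close> and frozen on reaching
  \<open>z\<close>: its mass at \<open>z\<close> after \<open>n\<close> steps is the probability
  that \<open>K\<close> visits \<open>z\<close> within \<open>n\<close> steps.\<close>

primrec absorbed :: "('s \<Rightarrow> 's pmf) \<Rightarrow> 's \<Rightarrow> 's \<Rightarrow> nat \<Rightarrow> 's pmf" where
  "absorbed K z x 0 = return_pmf x"
| "absorbed K z x (Suc n) =
     bind_pmf (absorbed K z x n) (\<lambda>i. if i = z then return_pmf z else K i)"

text \<open>The expectation of \<open>h\<close> along the absorbed chain never increases, since the
  chain rests at \<open>z\<close> and \<open>h\<close> is superharmonic elsewhere. The state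
  \<open>z\<close> alone contributes the left-hand side to this expectation.\<close>

lemma absorbed_superharmonic:
  fixes h :: "'s \<Rightarrow> real"
  assumes nonneg: "\<And>i. 0 \<le> h i" and bdd: "\<And>i. h i \<le> B"
    and super: "\<And>i. i \<noteq> z \<Longrightarrow> measure_pmf.expectation (K i) h \<le> h i"
  shows "pmf (absorbed K z x n) z * h z \<le> h x"
proof -
  have abs_h: "\<bar>h i\<bar> \<le> B" for i
    using nonneg[of i] bdd[of i] by simp
  have le: "measure_pmf.expectation (absorbed K z x n) h \<le> h x"
  proof (induction n)
    case (Suc n)
    have "measure_pmf.expectation (absorbed K z x (Suc n)) h
        = measure_pmf.expectation (absorbed K z x n)
            (\<lambda>i. measure_pmf.expectation (if i = z then return_pmf z else K i) h)"
      by (simp add: expectation_bind_pmf[OF abs_h])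
    also have "\<dots> \<le> measure_pmf.expectation (absorbed K z x n) h"
      by (intro expectation_pmf_mono[where B = B and B' = B] abs_expectation_pmf_le abs_h)
        (simp add: super)
    finally show ?case using Suc by simp
  qed simp
  show ?thesis
    by (rule order_trans[OF expectation_pmf_ge_single[where f = h, OF nonneg bdd] le])
qed

text \<open>
  Off \<open>z\<close> the expectation of \<open>v\<close> grows geometrically, so that bounded \<open>v\<close> forces all the mass
  carrying it to be absorbed.
\<close>

lemma absorbed_strictly_subharmonic:
  fixes v :: "'s \<Rightarrow> real"
  assumes bdd: "\<And>i. \<bar>v i\<bar> \<le> B" and "0 \<le> v z" and "0 < \<kappa>"
    and sub: "\<And>i. i \<noteq> z \<Longrightarrow> (1 + \<kappa>) * v i \<le> measure_pmf.expectation (K i) v"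
    and a: "\<And>n. pmf (absorbed K z x n) z \<le> a"
  shows "v x \<le> v z * a"
proof (rule ccontr)
  assume "\<not> v x \<le> v z * a"
  define e where "e n = measure_pmf.expectation (absorbed K z x n) v" for n
  \<comment> \<open>Frozen mass at \<open>z\<close> does not grow, which costs
    \<open>\<kappa> * v z\<close> times that mass, hence at most \<open>\<kappa> * v z * a\<close>.
    Centring at \<open>v z * a\<close> absorbs this cost.\<close>
  have step: "(1 + \<kappa>) * (e n - v z * a) \<le> e (Suc n) - v z * a" for n
  proof -
    have int: "integrable (measure_pmf (absorbed K z x n)) v"
      by (rule integrable_pmf_bounded[OF bdd])
    have "(1 + \<kappa>) * e n - \<kappa> * v z * pmf (absorbed K z x n) z
        = measure_pmf.expectation (absorbed K z x n)
            (\<lambda>i. (1 + \<kappa>) * v i - \<kappa> * v z * indicator {z} i)"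
      unfolding e_def by (subst Bochner_Integration.integral_diff)
        (simp_all add: int measure_pmf_single integrable_pmf_bounded[where B = 1])
    also have "\<dots> \<le> measure_pmf.expectation (absorbed K z x n)
            (\<lambda>i. measure_pmf.expectation (if i = z then return_pmf z else K i) v)"
    proof (intro integral_mono)
      show "integrable (measure_pmf (absorbed K z x n))
          (\<lambda>i. measure_pmf.expectation (if i = z then return_pmf z else K i) v)"
        by (intro integrable_pmf_bounded[where B = B] abs_expectation_pmf_le bdd)
      show "integrable (measure_pmf (absorbed K z x n))
          (\<lambda>i. (1 + \<kappa>) * v i - \<kappa> * v z * indicator {z} i)"
        by (intro Bochner_Integration.integrable_diff integrable_mult_right int
            integrable_pmf_bounded[where B = 1]) (simp add: indicator_def)
      show "(1 + \<kappa>) * v i - \<kappa> * v z * indicator {z} i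
          \<le> measure_pmf.expectation (if i = z then return_pmf z else K i) v" for i
        using sub[of i] by (cases "i = z") (simp_all add: algebra_simps)
    qed
    also have "\<dots> = e (Suc n)"
      by (simp add: e_def expectation_bind_pmf[OF bdd])
    finally have "(1 + \<kappa>) * e n - \<kappa> * v z * pmf (absorbed K z x n) z \<le> e (Suc n)" .
    moreover have "\<kappa> * v z * pmf (absorbed K z x n) z \<le> \<kappa> * v z * a"
      using assms by (intro mult_left_mono) auto
    ultimately show ?thesis by (simp add: algebra_simps)
  qed
  have growth: "(1 + \<kappa>) ^ n * (v x - v z * a) \<le> e n - v z * a" for n
  proof (induction n)
    case (Suc n)
    have "(1 + \<kappa>) ^ Suc n * (v x - v z * a) \<le> (1 + \<kappa>) * (e n - v z * a)"
      using Suc \<open>0 < \<kappa>\<close> by simp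
    from this step[of n] show ?case by (rule order_trans)
  qed (simp add: e_def)
  \<comment> \<open>If the initial excess \<open>v x - v z * a\<close> were positive, its geometric
    growth would exceed the bound \<open>B\<close>.\<close>
  obtain n where n: "(B - v z * a) / (v x - v z * a) < (1 + \<kappa>) ^ n"
    using real_arch_pow[of "1 + \<kappa>"] \<open>0 < \<kappa>\<close> by auto
  have "B - v z * a < (1 + \<kappa>) ^ n * (v x - v z * a)"
    using n \<open>\<not> v x \<le> v z * a\<close> by (simp add: pos_divide_less_eq)
  also note growth
  also have "e n \<le> B"
    using abs_expectation_pmf_le[OF bdd, of "absorbed K z x n"] by (simp add: e_def abs_le_iff)
  finally show False by simp
qed

subsection \<open>Semigroups with bounded jump rates\<close>

text \<open>A common bound on the exit rates makes difference quotients at time \<open>0\<close>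
  bounded uniformly in the state, as dominated convergence requires. Finitely many successors make
  the generator a finite sum.\<close>

locale bounded_rate_semigroup =
  fixes p :: "real \<Rightarrow> 's \<Rightarrow> 's pmf" and q :: "'s \<Rightarrow> 's \<Rightarrow> real" and C :: real
  assumes semigroup: "transition_semigroup p"
    and jump_rates: "has_jump_rates p q"
    and finite_rates: "finite {j. j \<noteq> i \<and> q i j \<noteq> 0}"
    and exit_rate_le: "(\<Sum>j | j \<noteq> i \<and> q i j \<noteq> 0. q i j) \<le> C"
begin

definition gen :: "('s \<Rightarrow> real) \<Rightarrow> 's \<Rightarrow> real" where
  "gen f i = (\<Sum>j | j \<noteq> i \<and> q i j \<noteq> 0. q i j * (f j - f i))"

abbreviation E :: "real \<Rightarrow> ('s \<Rightarrow> real) \<Rightarrow> 's \<Rightarrow> real" where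
  "E t f i \<equiv> measure_pmf.expectation (p t i) f"

lemma p_0: "p 0 i = return_pmf i"
  using semigroup by (simp add: transition_semigroup_def)

lemma p_add: "0 \<le> s \<Longrightarrow> 0 \<le> t \<Longrightarrow> p (s + t) i = bind_pmf (p s i) (p t)"
  using semigroup by (simp add: transition_semigroup_def)

lemma E_add:
  assumes "\<And>j. \<bar>f j\<bar> \<le> B" "0 \<le> s" "0 \<le> t"
  shows "E (s + t) f i = E s (E t f) i"
  unfolding p_add[OF assms(2,3)] by (rule expectation_bind_pmf[OF assms(1)])

lemma exit_rate_nonneg: "0 \<le> (\<Sum>j | j \<noteq> i \<and> q i j \<noteq> 0. q i j)"
  using jump_rates by (intro sum_nonneg) (auto simp: has_jump_rates_def)

lemma C_nonneg: "0 \<le> C"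
  using exit_rate_nonneg exit_rate_le by (rule order_trans)

lemma generator_diag: "generator q i i = - (\<Sum>j | j \<noteq> i \<and> q i j \<noteq> 0. q i j)"
proof -
  have "(\<Sum>\<^sub>\<infinity>k\<in>-{i}. q i k) = (\<Sum>\<^sub>\<infinity>k\<in>{j. j \<noteq> i \<and> q i j \<noteq> 0}. q i k)"
    by (rule infsum_cong_neutral) auto
  then show ?thesis by (simp add: generator_def finite_rates)
qed

lemma pmf_deriv:
  "((\<lambda>t. pmf (p t i) j) has_real_derivative generator q i j) (at 0 within {0..})"
  using jump_rates by (simp add: has_jump_rates_def)

lemma pmf_mult_le:
  assumes "0 \<le> s" "0 \<le> t"
  shows "pmf (p s i) j * pmf (p t j) k \<le> pmf (p (s + t) i) k"
  unfolding p_add[OF assms] pmf_bind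
  by (rule expectation_pmf_ge_single[where f = "\<lambda>j. pmf (p t j) k" and B = 1]) (simp_all add: pmf_le_1)

lemma pmf_power_le:
  assumes "0 \<le> t"
  shows "pmf (p t i) i ^ n \<le> pmf (p (real n * t) i) i"
proof (induction n)
  case (Suc n)
  have "pmf (p t i) i ^ Suc n \<le> pmf (p t i) i * pmf (p (real n * t) i) i"
    using Suc by (simp add: mult_left_mono)
  also have "\<dots> \<le> pmf (p (t + real n * t) i) i"
    using assms by (intro pmf_mult_le) auto
  finally show ?case by (simp add: algebra_simps)
qed (simp add: p_0)

text \<open>The derivative at \<open>0\<close> controls staying only for short times. Cutting
  \<open>t\<close> into equal short pieces, staying at \<open>i\<close> at all grid points bounds
  the probability from below by a power, which Bernoulli's inequality linearises.\<close>

lemma pmf_stay_ge: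
  assumes "0 \<le> t"
  shows "1 - C * t \<le> pmf (p t i) i"
proof (cases "t = 0")
  case False
  with assms have "0 < t" by simp
  show ?thesis
  proof (rule field_le_epsilon)
    fix e :: real assume "0 < e"
    define D where "D = - generator q i i"
    have D: "D \<le> C" using exit_rate_le by (simp add: D_def generator_diag)
    have "((\<lambda>s. (pmf (p s i) i - 1) / s) \<longlongrightarrow> - D) (at_right 0)"
      using pmf_deriv[of i i]
      by (simp add: has_field_derivative_iff p_0 D_def at_within_Ici_at_right)
    moreover have "LIM n sequentially. t / real (Suc n) :> at_right 0"
      using \<open>0 < t\<close> by real_asymp
    ultimately have "(\<lambda>n. (pmf (p (t / real (Suc n)) i) i - 1) / (t / real (Suc n))) \<longlonglongrightarrow> - D"
      by (rule filterlim_compose)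
    \<comment> \<open>The slack \<open>e / t\<close> per unit of time adds up to \<open>e\<close>
      over the whole of \<open>[0, t]\<close>.\<close>
    then have "\<forall>\<^sub>F n in sequentially.
        - D - e / t < (pmf (p (t / real (Suc n)) i) i - 1) / (t / real (Suc n))"
      by (rule order_tendstoD) (use \<open>0 < e\<close> \<open>0 < t\<close> in simp)
    \<comment> \<open>Keeps the base of the power positive, so that powers are monotone and
      Bernoulli's inequality applies.\<close>
    moreover have "\<forall>\<^sub>F n in sequentially. (D + e / t) * t / real (Suc n) < 1"
      by real_asymp
    ultimately have "\<forall>\<^sub>F n in sequentially. 1 - D * t - e \<le> pmf (p t i) i"
    proof eventually_elim
      case (elim n)
      define s where "s = t / real (Suc n)"
      have s: "0 < s" "real (Suc n) * s = t" using \<open>0 < t\<close> by (simp_all add: s_def)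
      have eq: "(D + e / t) * t / real (Suc n) = (D + e / t) * s" by (simp add: s_def)
      have "1 - (D + e / t) * s \<le> pmf (p s i) i"
        using elim(1) s(1) unfolding s_def[symmetric] by (simp add: field_simps)
      then have "(1 - (D + e / t) * s) ^ Suc n \<le> pmf (p s i) i ^ Suc n"
        using elim(2) unfolding eq by (intro power_mono) auto
      also have "\<dots> \<le> pmf (p t i) i"
        using pmf_power_le[of s i "Suc n"] s by simp
      finally have "(1 - (D + e / t) * s) ^ Suc n \<le> pmf (p t i) i" .
      moreover have "1 + real (Suc n) * (- ((D + e / t) * s)) \<le> (1 + - ((D + e / t) * s)) ^ Suc n"
        using elim(2) unfolding eq by (intro Bernoulli_inequality) auto
      moreover have "real (Suc n) * (- ((D + e / t) * s)) = - (D * t + e)"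
      proof -
        have "real (Suc n) * (- ((D + e / t) * s)) = - ((D + e / t) * (real (Suc n) * s))"
          by (metis mult.left_commute mult_minus_right)
        also have "\<dots> = - (D * t + e)" unfolding s using \<open>0 < t\<close> by (simp add: distrib_right)
        finally show ?thesis .
      qed
      ultimately show ?case by simp
    qed
    then have "1 - D * t - e \<le> pmf (p t i) i" by simp
    moreover have "D * t \<le> C * t" using D assms by (rule mult_right_mono)
    ultimately show "1 - C * t \<le> pmf (p t i) i + e" by simp
  qed
qed (simp add: p_0)

text \<open>The integrand \<open>f j - f i\<close> vanishes at \<open>i\<close> and is at most
  \<open>2 * B\<close> elsewhere, where the mass is at most \<open>C * t\<close>.\<close>

lemma E_diff_le:
  assumes f: "\<And>j. \<bar>f j\<bar> \<le> B" and "0 \<le> t"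
  shows "\<bar>E t f i - f i\<bar> \<le> 2 * B * C * t"
proof -
  have "0 \<le> B" using f[of i] by simp
  have int: "integrable (measure_pmf (p t i)) f" by (rule integrable_pmf_bounded[OF f])
  have le: "\<bar>f j - f i\<bar> \<le> 2 * B * indicator (-{i}) j" for j
    using f[of i] f[of j] by (auto simp: indicator_def)
  have "\<bar>E t f i - f i\<bar> = \<bar>E t (\<lambda>j. f j - f i) i\<bar>"
    by (simp add: int)
  also have "\<dots> \<le> E t (\<lambda>j. \<bar>f j - f i\<bar>) i"
    by (rule integral_abs_bound)
  also have "\<dots> \<le> E t (\<lambda>j. 2 * B * indicator (-{i}) j) i"
    using int le by (intro integral_mono integrable_pmf_bounded[where B = "2 * B"])
      (auto simp: indicator_def \<open>0 \<le> B\<close> split: if_splits intro: order_trans[OF le])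
  also have "\<dots> = 2 * B * (1 - pmf (p t i) i)"
    using measure_pmf.prob_compl[of "{i}" "p t i"] by (simp add: Compl_eq_Diff_UNIV measure_pmf_single)
  also have "\<dots> \<le> 2 * B * (C * t)"
    using pmf_stay_ge[OF \<open>0 \<le> t\<close>, of i] \<open>0 \<le> B\<close> by (intro mult_left_mono) auto
  finally show ?thesis by (simp add: algebra_simps)
qed

text \<open>
  The mass outside \<open>i\<close> and its finitely many successors has derivative \<open>0\<close> at time \<open>0\<close>, because
  the rates out of \<open>i\<close> sum up to the total rate of leaving \<open>i\<close>.
\<close>

lemma E_tendsto_gen:
  assumes f: "\<And>j. \<bar>f j\<bar> \<le> B"
  shows "((\<lambda>s. (E s f i - f i) / s) \<longlongrightarrow> gen f i) (at_right 0)"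
proof -
  define J where "J = {j. j \<noteq> i \<and> q i j \<noteq> 0}"
  define F where "F = insert i J"
  define R where "R s = E s (\<lambda>j. f j * indicator (-F) j) i" for s
  define m where "m s = 1 - (\<Sum>j\<in>F. pmf (p s i) j)" for s
  have fin: "finite F" "finite J" "i \<notin> J"
    using finite_rates[of i] by (simp_all add: F_def J_def)
  have split: "E s f i = (\<Sum>j\<in>F. pmf (p s i) j * f j) + R s" for s
  proof -
    have "E s f i = E s (\<lambda>j. f j * indicator F j + f j * indicator (-F) j) i"
      by (intro arg_cong[where f = "measure_pmf.expectation _"]) (auto simp: indicator_def)
    also have "\<dots> = E s (\<lambda>j. f j * indicator F j) i + R s"
      unfolding R_def using f
      by (intro Bochner_Integration.integral_add integrable_pmf_bounded[where B = B])
        (auto simp: indicator_def intro: order_trans[OF abs_ge_zero f])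
    also have "E s (\<lambda>j. f j * indicator F j) i = (\<Sum>j\<in>F. f j * indicator F j * pmf (p s i) j)"
      using fin by (intro integral_measure_pmf_real) (auto simp: indicator_def split: if_splits)
    also have "\<dots> = (\<Sum>j\<in>F. pmf (p s i) j * f j)"
      by (intro sum.cong) auto
    finally show ?thesis .
  qed
  have R_le: "\<bar>R s\<bar> \<le> B * m s" for s
  proof -
    have "\<bar>R s\<bar> \<le> E s (\<lambda>j. \<bar>f j * indicator (-F) j\<bar>) i"
      unfolding R_def by (rule integral_abs_bound)
    also have "\<dots> \<le> E s (\<lambda>j. B * indicator (-F) j) i"
      using f by (intro expectation_pmf_mono[where B = B and B' = B])
        (auto simp: indicator_def abs_mult intro: order_trans[OF abs_ge_zero f])
    also have "\<dots> = B * m s"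
      using measure_pmf.prob_compl[of F "p s i"] fin
      by (simp add: m_def Compl_eq_Diff_UNIV measure_measure_pmf_finite)
    finally show ?thesis .
  qed
  have sums: "(\<Sum>j\<in>F. generator q i j * g j) = (\<Sum>j\<in>J. q i j * (g j - g i))" for g :: "'s \<Rightarrow> real"
  proof -
    have "(\<Sum>j\<in>J. generator q i j * g j) = (\<Sum>j\<in>J. q i j * g j)"
      by (intro sum.cong) (auto simp: J_def generator_def)
    then show ?thesis
      using fin by (simp add: F_def generator_diag algebra_simps sum_subtractf sum_distrib_left
          flip: J_def)
  qed
  have lim: "((\<lambda>s. ((\<Sum>j\<in>F. pmf (p s i) j * g j) - g i) / s) \<longlongrightarrow> (\<Sum>j\<in>J. q i j * (g j - g i))) (at_right 0)"
    for g :: "'s \<Rightarrow> real"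
  proof -
    have "((\<lambda>s. \<Sum>j\<in>F. pmf (p s i) j * g j) has_real_derivative (\<Sum>j\<in>F. generator q i j * g j))
        (at 0 within {0..})"
      by (intro DERIV_sum DERIV_cmult_right pmf_deriv)
    moreover have "(\<Sum>j\<in>F. pmf (p 0 i) j * g j) = g i"
    proof -
      have "(\<Sum>j\<in>F. pmf (p 0 i) j * g j) = (\<Sum>j\<in>F. if i = j then g j else 0)"
        by (intro sum.cong) (auto simp: p_0 indicator_def)
      then show ?thesis using fin by (simp add: F_def)
    qed
    ultimately show ?thesis
      by (simp add: has_field_derivative_iff sums at_within_Ici_at_right)
  qed
  have "((\<lambda>s. R s / s) \<longlongrightarrow> 0) (at_right 0)"
  proof (rule Lim_null_comparison)
    \<comment> \<open>The bound is \<open>B * m s / s\<close>, written as a difference quotient of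
      the mass of \<open>F\<close> so that \<open>lim\<close> applies with the constant function
      \<open>1\<close>.\<close>
    show "\<forall>\<^sub>F s in at_right 0. norm (R s / s) \<le> - B * ((1 - m s - 1) / s)"
      unfolding eventually_at_filter
      by (intro always_eventually allI impI) (use R_le in \<open>simp add: divide_right_mono\<close>)
    show "((\<lambda>s. - B * ((1 - m s - 1) / s)) \<longlongrightarrow> 0) (at_right 0)"
      using tendsto_mult[OF tendsto_const lim[of "\<lambda>_. 1"], of "- B"] by (simp add: m_def)
  qed
  from tendsto_add[OF lim[of f] this] show ?thesis
    by (simp add: split gen_def J_def add_divide_distrib diff_divide_distrib algebra_simps)
qed

section \<open>Lipschitz continuity in time and the forward equation\<close>

lemma E_increment:
  assumes f: "\<And>j. \<bar>f j\<bar> \<le> B" and "0 \<le> s" "0 \<le> t"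
  shows "E (s + t) f i - E s f i = E s (\<lambda>j. E t f j - f j) i"
  unfolding E_add[OF assms]
  by (intro Bochner_Integration.integral_diff[symmetric] integrable_pmf_bounded[where B = B]
      abs_expectation_pmf_le f)

lemma E_increment_le:
  assumes f: "\<And>j. \<bar>f j\<bar> \<le> B" and "0 \<le> s" "0 \<le> t"
  shows "\<bar>E (s + t) f i - E s f i\<bar> \<le> 2 * B * C * t"
  unfolding E_increment[OF assms]
  by (intro abs_expectation_pmf_le E_diff_le f \<open>0 \<le> t\<close>)

lemma continuous_on_E:
  assumes f: "\<And>j. \<bar>f j\<bar> \<le> B"
  shows "continuous_on {0..} (\<lambda>t. E t f i)"
proof (rule lipschitz_on_continuous_on[OF lipschitz_onI])
  have le: "\<bar>E y f i - E x f i\<bar> \<le> 2 * B * C * (y - x)" if "0 \<le> x" "x \<le> y" for x y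
    using E_increment_le[OF f, of x "y - x" i] that by simp
  show "dist (E x f i) (E y f i) \<le> 2 * B * C * dist x y" if "x \<in> {0..}" "y \<in> {0..}" for x y
    using le[of x y] le[of y x] that by (cases "x \<le> y") (auto simp: dist_real_def)
  show "0 \<le> 2 * B * C"
    using order_trans[OF abs_ge_zero f] C_nonneg by simp
qed

text \<open>By the semigroup property the right difference quotient at \<open>t\<close> is the
  expectation at time \<open>t\<close> of the quotients at \<open>0\<close>. These tend to
  \<open>gen f\<close> pointwise and are bounded by \<open>2 * B * C\<close>, so dominated
  convergence applies.\<close>

lemma E_deriv:
  assumes f: "\<And>j. \<bar>f j\<bar> \<le> B" and "0 < t"
  shows "((\<lambda>t. E t f i) has_real_derivative E t (gen f) i) (at t)"
proof -
  define D where "D h j = (E h f j - f j) / h" for h j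
  have "0 \<le> B" using order_trans[OF abs_ge_zero f] .
  have D_le: "\<bar>D h j\<bar> \<le> 2 * B * C" if "0 < h" for h j
    using E_diff_le[OF f, of h j] that by (simp add: D_def abs_divide pos_divide_le_eq)
  have quot: "(E (s + h) f i - E s f i) / h = E s (D h) i" if "0 \<le> s" "0 < h" for s h
    using that by (simp add: E_increment[OF f] D_def[abs_def])
  have "((\<lambda>h. E t (D h) i) \<longlongrightarrow> E t (gen f) i) (at_right 0)"
    unfolding tendsto_at_iff_sequentially comp_def
  proof (intro allI impI)
    fix h :: "nat \<Rightarrow> real" assume h: "\<forall>n. h n \<in> {0<..} - {0}" "h \<longlonglongrightarrow> 0"
    show "(\<lambda>n. E t (D (h n)) i) \<longlonglongrightarrow> E t (gen f) i"
    proof (rule integral_dominated_convergence[where w = "\<lambda>_. 2 * B * C"])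
      show "AE j in measure_pmf (p t i). (\<lambda>n. D (h n) j) \<longlonglongrightarrow> gen f j"
      proof (rule AE_I2)
        fix j
        show "(\<lambda>n. D (h n) j) \<longlonglongrightarrow> gen f j"
          unfolding D_def
          by (rule E_tendsto_gen[OF f, of j, unfolded tendsto_at_iff_sequentially comp_def, rule_format])
            (use h in auto)
      qed
    qed (use h D_le in auto)
  qed
  moreover have "LIM h at 0. \<bar>h\<bar> :> at_right (0::real)"
    by real_asymp
  ultimately have lim: "((\<lambda>h. E t (D \<bar>h\<bar>) i) \<longlongrightarrow> E t (gen f) i) (at 0)"
    by (rule filterlim_compose)
  \<comment> \<open>For \<open>h < 0\<close> the quotient has base point \<open>t + h\<close>
    instead of \<open>t\<close>; the Lipschitz estimate makes the discrepancy
    \<open>O(\<bar>h\<bar>)\<close>.\<close>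
  have "((\<lambda>h. (E (t + h) f i - E t f i) / h - E t (D \<bar>h\<bar>) i) \<longlongrightarrow> 0) (at 0)"
  proof (rule Lim_null_comparison)
    have "\<forall>\<^sub>F h in at 0. - t < h"
      using \<open>0 < t\<close> by real_asymp
    moreover have "\<forall>\<^sub>F h in at (0::real). h \<noteq> 0"
      by (simp add: eventually_at_filter)
    ultimately show "\<forall>\<^sub>F h in at 0. norm ((E (t + h) f i - E t f i) / h - E t (D \<bar>h\<bar>) i)
        \<le> 2 * (2 * B * C) * C * \<bar>h\<bar>"
    proof eventually_elim
      case (elim h)
      show ?case
      proof (cases "0 < h")
        case True
        then show ?thesis using quot[of t h] \<open>0 < t\<close> \<open>0 \<le> B\<close> C_nonneg by simp
      next
        case False
        then have "(E (t + h) f i - E t f i) / h = E (t + h) (D \<bar>h\<bar>) i"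
          using quot[of "t + h" "- h"] elim by (simp add: minus_divide_left[symmetric] field_simps)
        then show ?thesis
          using E_increment_le[of "D \<bar>h\<bar>" "2 * B * C" "t + h" "\<bar>h\<bar>" i] D_le[of "\<bar>h\<bar>"] elim False
          by (simp add: abs_minus_commute)
      qed
    qed
    show "((\<lambda>h. 2 * (2 * B * C) * C * \<bar>h\<bar>) \<longlongrightarrow> 0) (at 0)"
      by (intro tendsto_eq_intros) auto
  qed
  from tendsto_add[OF this lim] show ?thesis
    by (simp add: DERIV_def)
qed

text \<open>An integrated forward equation: \<open>E s f i - A * s\<close> has nonnegative
  derivative for \<open>0 < s < t\<close>, and continuity includes the endpoints.\<close>

lemma E_ge:
  assumes f: "\<And>j. \<bar>f j\<bar> \<le> B" and "0 \<le> t"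
    and A: "\<And>s. 0 < s \<Longrightarrow> s < t \<Longrightarrow> A \<le> E s (gen f) i"
  shows "f i + A * t \<le> E t f i"
proof -
  have "E 0 f i - A * 0 \<le> E t f i - A * t"
  proof (rule DERIV_nonneg_imp_increasing_open[OF \<open>0 \<le> t\<close>])
    show "\<exists>y. ((\<lambda>s. E s f i - A * s) has_real_derivative y) (at s) \<and> 0 \<le> y"
      if "0 < s" "s < t" for s
      using A[OF that] by (intro exI conjI) (rule derivative_eq_intros E_deriv[OF f \<open>0 < s\<close>] refl | simp)+
    show "continuous_on {0..t} (\<lambda>s. E s f i - A * s)"
      by (intro continuous_intros continuous_on_subset[OF continuous_on_E[OF f]]) auto
  qed
  then show ?thesis by (simp add: p_0)
qed

lemma E_superharmonic:
  assumes f: "\<And>j. \<bar>f j\<bar> \<le> B" and "0 \<le> t" and "\<And>j. gen f j \<le> 0"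
  shows "E t f i \<le> f i"
proof -
  have gen_minus: "gen (\<lambda>j. - f j) = (\<lambda>j. - gen f j)"
    by (auto simp: gen_def fun_eq_iff algebra_simps simp flip: sum_negf)
  have "- f i + 0 * t \<le> E t (\<lambda>j. - f j) i"
  proof (rule E_ge[where B = B])
    show "0 \<le> E s (gen (\<lambda>j. - f j)) i" for s
      unfolding gen_minus using assms by (intro integral_nonneg_AE) auto
  qed (use assms in auto)
  then show ?thesis by simp
qed

end

subsection \<open>The M/M/1 queue\<close>

locale mm1_semigroup =
  fixes p :: "real \<Rightarrow> nat \<Rightarrow> nat pmf" and lam \<mu> :: real
  assumes semigroup_p: "transition_semigroup p"
    and jump_rates_p: "has_jump_rates p (mm1_rate lam \<mu>)"
    and mu_pos: "0 < \<mu>" and lam_gt: "\<mu> < lam"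
begin

lemma successors:
  "{j. j \<noteq> i \<and> mm1_rate lam \<mu> i j \<noteq> 0} = (if i = 0 then {1} else {i - 1, i + 1})"
  using mu_pos lam_gt by (auto simp: mm1_rate_def)

sublocale bounded_rate_semigroup p "mm1_rate lam \<mu>" "lam + \<mu>"
proof
  show "(\<Sum>j | j \<noteq> i \<and> mm1_rate lam \<mu> i j \<noteq> 0. mm1_rate lam \<mu> i j) \<le> lam + \<mu>" for i
    unfolding successors using mu_pos by (cases i) (simp_all add: mm1_rate_def)
  show "finite {j. j \<noteq> i \<and> mm1_rate lam \<mu> i j \<noteq> 0}" for i
    unfolding successors by simp
qed (rule semigroup_p jump_rates_p)+

lemma gen_0: "gen f 0 = lam * (f 1 - f 0)"
  by (simp only: gen_def successors) (simp add: mm1_rate_def)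

lemma gen_Suc: "gen f (Suc n) = lam * (f (Suc (Suc n)) - f (Suc n)) + \<mu> * (f n - f (Suc n))"
  by (simp only: gen_def successors) (simp add: mm1_rate_def)

text \<open>On \<open>x ^ i\<close> the generator produces the factor
  \<open>(lam * x - \<mu>) * (x - 1)\<close> off \<open>0\<close>, which vanishes at
  \<open>x = \<mu> / lam\<close>. At \<open>0\<close> it gives \<open>\<mu> - lam < 0\<close>; this
  sign matters because the chain may pass through \<open>0\<close> between grid times.\<close>

lemma absorbed_le:
  assumes "0 \<le> \<delta>"
  shows "pmf (absorbed (p \<delta>) 0 1 n) 0 \<le> \<mu> / lam"
proof -
  define h where "h i = (\<mu> / lam) ^ i" for i :: nat
  have h: "0 \<le> h i" "h i \<le> 1" for i
    using mu_pos lam_gt by (auto simp: h_def intro!: power_le_one)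
  have "gen h i \<le> 0" for i
  proof (cases i)
    case 0
    then show ?thesis using mu_pos lam_gt by (simp add: gen_0 h_def field_simps)
  next
    case (Suc k)
    have "gen h (Suc k) = (\<mu> / lam) ^ k * ((lam * (\<mu> / lam) - \<mu>) * (\<mu> / lam - 1))"
      by (simp add: gen_Suc h_def algebra_simps)
    then show ?thesis using Suc mu_pos lam_gt by simp
  qed
  then have "measure_pmf.expectation (p \<delta> i) h \<le> h i" for i
    using h by (intro E_superharmonic[where B = 1] assms) auto
  from absorbed_superharmonic[of h 1 0 "p \<delta>" 1 n, OF h this] show ?thesis
    by (simp add: h_def)
qed

text \<open>
  For \<open>r < \<mu> / lam\<close> the function \<open>i \<mapsto> r ^ i\<close> is an eigenfunction of the generator with
  eigenvalue \<open>c > 0\<close>, except at \<open>0\<close>.  The chain \<open>p \<delta>\<close> may leave \<open>0\<close> and come back within one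
  step, at a cost proportional to the probability of being at \<open>0\<close> at some \<open>s < \<delta>\<close>.  This is at
  most twice the probability of being at \<open>0\<close> at time \<open>\<delta>\<close> and is paid for by raising the value
  at \<open>0\<close>.
\<close>

lemma absorbed_ge:
  assumes r: "0 < r" "r < \<mu> / lam"
  shows "\<exists>K. \<forall>\<delta> a. 0 < \<delta> \<longrightarrow> (lam + \<mu>) * \<delta> \<le> 1 / 2 \<longrightarrow>
    (\<forall>n. pmf (absorbed (p \<delta>) 0 1 n) 0 \<le> a) \<longrightarrow> r \<le> (1 + K * \<delta>) * a"
proof -
  define g where "g i = r ^ i" for i :: nat
  define c where "c = (lam * r - \<mu>) * (r - 1) / r"
  \<comment> \<open>At \<open>0\<close> the generator gives \<open>lam * (r - 1)\<close> instead of
    \<open>c\<close>; \<open>K\<close> is the defect.\<close>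
  define K where "K = c + lam * (1 - r)"
  have "r < 1"
    using r mu_pos lam_gt by (intro less_trans[OF r(2)]) (simp add: field_simps)
  have "lam * r < \<mu>" using r mu_pos lam_gt by (simp add: field_simps)
  have "0 < c"
    unfolding c_def using \<open>0 < r\<close> \<open>r < 1\<close> \<open>lam * r < \<mu>\<close>
    by (intro divide_pos_pos mult_neg_neg) auto
  have "0 \<le> K" using \<open>0 < c\<close> \<open>r < 1\<close> mu_pos lam_gt by (simp add: K_def)
  have g: "0 \<le> g i" "g i \<le> 1" "\<bar>g i\<bar> \<le> 1" for i
    using r \<open>r < 1\<close> by (auto simp: g_def intro!: power_le_one)
  have gen_g: "gen g = (\<lambda>i. c * g i - K * indicator {0} i)"
  proof
    fix i show "gen g i = c * g i - K * indicator {0} i"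
    proof (cases i)
      case (Suc k)
      have "gen g (Suc k) = r ^ k * ((lam * r - \<mu>) * (r - 1))"
        by (simp add: gen_Suc g_def algebra_simps)
      with Suc r show ?thesis by (simp add: g_def c_def)
    qed (simp add: gen_0 g_def K_def algebra_simps)
  qed
  have "r \<le> (1 + 2 * K * \<delta>) * a"
    if \<delta>: "0 < \<delta>" "(lam + \<mu>) * \<delta> \<le> 1 / 2" and a: "\<And>n. pmf (absorbed (p \<delta>) 0 1 n) 0 \<le> a" for \<delta> a
  proof -
    have half: "1 / 2 \<le> pmf (p s i) i" if "0 \<le> s" "s \<le> \<delta>" for s i
    proof -
      have "(lam + \<mu>) * s \<le> (lam + \<mu>) * \<delta>" using that C_nonneg by (intro mult_left_mono)
      with pmf_stay_ge[OF \<open>0 \<le> s\<close>, of i] \<delta>(2) show ?thesis by linarith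
    qed
    define v where "v i = g i + 2 * K * \<delta> * indicator {0} i" for i
    have step: "(1 + c * \<delta> / 2) * v i \<le> E \<delta> v i" if "i \<noteq> 0" for i
    proof -
      \<comment> \<open>Half of the growth rate \<open>c\<close> survives because the chain stays at
        \<open>i\<close> up to \<open>s\<close> with probability at least \<open>1 / 2\<close>. The
        loss is exactly the gain from the raise \<open>2 * K * \<delta>\<close> at \<open>0\<close>
        in \<open>v\<close>.\<close>
      have "g i + (c * (g i / 2) - K * (2 * pmf (p \<delta> i) 0)) * \<delta> \<le> E \<delta> g i"
      proof (rule E_ge[where B = 1])
        fix s assume s: "0 < s" "s < \<delta>"
        have "g i / 2 \<le> pmf (p s i) i * g i"
          using mult_right_mono[OF half[of s i] g(1)[of i]] s by simp
        also have "\<dots> \<le> E s g i"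
          by (rule expectation_pmf_ge_single[OF g(1,2)])
        finally have "g i / 2 \<le> E s g i" .
        moreover have "pmf (p s i) 0 * (1 / 2) \<le> pmf (p \<delta> i) 0"
        proof -
          have "pmf (p s i) 0 * (1 / 2) \<le> pmf (p s i) 0 * pmf (p (\<delta> - s) 0) 0"
            using s by (intro mult_left_mono half) auto
          also have "\<dots> \<le> pmf (p \<delta> i) 0"
            using pmf_mult_le[of s "\<delta> - s" i 0 0] s by simp
          finally show ?thesis .
        qed
        ultimately have "c * (g i / 2) - K * (2 * pmf (p \<delta> i) 0) \<le> c * E s g i - K * pmf (p s i) 0"
          using \<open>0 < c\<close> \<open>0 \<le> K\<close> by (intro diff_mono mult_left_mono) auto
        also have "\<dots> = E s (gen g) i"
          unfolding gen_g
          by (subst Bochner_Integration.integral_diff)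
            (simp_all add: measure_pmf_single integrable_pmf_bounded[where B = 1] g)
        finally show "c * (g i / 2) - K * (2 * pmf (p \<delta> i) 0) \<le> E s (gen g) i" .
      qed (use \<delta> g in auto)
      moreover have "E \<delta> v i = E \<delta> g i + 2 * K * \<delta> * pmf (p \<delta> i) 0"
        unfolding v_def
        by (subst Bochner_Integration.integral_add)
          (simp_all add: measure_pmf_single integrable_pmf_bounded[where B = 1] g)
      ultimately show ?thesis
        using that by (simp add: v_def algebra_simps)
    qed
    have "v 1 \<le> v 0 * a"
    proof (rule absorbed_strictly_subharmonic[where \<kappa> = "c * \<delta> / 2" and K = "p \<delta>" and B = "1 + 2 * K * \<delta>"])
      show "\<bar>v i\<bar> \<le> 1 + 2 * K * \<delta>" for i
      proof -
        have "0 \<le> 2 * K * \<delta>" using \<delta> \<open>0 \<le> K\<close> by simp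
        then show ?thesis using g[of i] by (auto simp: v_def indicator_def)
      qed
      show "0 \<le> v 0"
        using \<delta> \<open>0 \<le> K\<close> by (simp add: v_def g_def)
    qed (use step a \<delta> \<open>0 < c\<close> in auto)
    then show ?thesis by (simp add: v_def g_def)
  qed
  then show ?thesis
    by (intro exI[of _ "2 * K"]) auto
qed

end

subsection \<open>Discrete skeletons\<close>

text \<open>The law of the first \<open>n + 1\<close> states, in order of time, so that
  \<open>last\<close> is the current state; it is the law to be matched with the observed
  chain.\<close>

primrec path_pmf :: "('s \<Rightarrow> 's pmf) \<Rightarrow> 's \<Rightarrow> nat \<Rightarrow> 's list pmf" where
  "path_pmf K x 0 = return_pmf [x]"
| "path_pmf K x (Suc n) = bind_pmf (path_pmf K x n) (\<lambda>l. map_pmf (\<lambda>j. l @ [j]) (K (last l)))"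

lemma path_pmf_nonempty: "l \<in> set_pmf (path_pmf K x n) \<Longrightarrow> l \<noteq> []"
  by (cases n) auto

lemma pmf_path_pmf_Suc:
  "pmf (path_pmf K x (Suc n)) (l @ [j]) = pmf (path_pmf K x n) l * pmf (K (last l)) j"
proof -
  have "pmf (map_pmf (\<lambda>j. l' @ [j]) (K (last l'))) (l @ [j]) = indicator {l} l' * pmf (K (last l)) j" for l'
  proof (cases "l' = l")
    case True
    then show ?thesis
      using pmf_map_inj'[of "\<lambda>j. l @ [j]" "K (last l)" j] by (simp add: inj_def)
  qed (auto simp: pmf_eq_0_set_pmf)
  then show ?thesis
    by (simp add: pmf_bind measure_pmf_single)
qed

text \<open>Couples the absorbed chain with the free one: by induction, both sides stay at
  \<open>z\<close> once it is visited and move by \<open>K\<close> before that.\<close>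

lemma absorbed_eq_map_path_pmf:
  "absorbed K z x n = map_pmf (\<lambda>l. if z \<in> set l then z else last l) (path_pmf K x n)"
proof (induction n)
  case (Suc n)
  have "map_pmf (\<lambda>j. if z \<in> set (l @ [j]) then z else last (l @ [j])) (K (last l))
      = (if (if z \<in> set l then z else last l) = z then return_pmf z
         else K (if z \<in> set l then z else last l))"
    if "l \<in> set_pmf (path_pmf K x n)" for l
  proof (cases "z \<in> set l")
    case False
    moreover have "last l \<noteq> z"
      using False last_in_set[OF path_pmf_nonempty[OF that]] by blast
    ultimately show ?thesis by (simp cong: if_cong)
  qed simp
  then show ?case
    by (simp add: Suc map_bind_pmf bind_map_pmf pmf.map_comp comp_def cong: bind_pmf_cong_simp)
qed simp

lemma measure_path_pmf_visit:
  "measure (path_pmf K x n) {l. z \<in> set l} = pmf (absorbed K z x n) z"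
proof -
  have "pmf (absorbed K z x n) z
      = measure (path_pmf K x n) {l. (if z \<in> set l then z else last l) = z}"
    by (simp add: absorbed_eq_map_path_pmf pmf_map vimage_def)
  also have "\<dots> = measure (path_pmf K x n) {l. z \<in> set l}"
    by (intro measure_pmf.finite_measure_eq_AE AE_pmfI)
      (auto dest!: path_pmf_nonempty intro: last_in_set split: if_splits)
  finally show ?thesis ..
qed

section \<open>The chain observed on a grid of times\<close>

context ctmc
begin

text \<open>The last clause of the assumption \<open>markov\<close> for one fixed \<open>p\<close>,
  so that the semigroup obtained from the existential can be handed to lemmas.\<close>

definition markov_semigroup :: "(real \<Rightarrow> 's \<Rightarrow> 's pmf) \<Rightarrow> bool" where
  "markov_semigroup p \<longleftrightarrow>
     (\<forall>n (t :: nat \<Rightarrow> real) x.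
        0 \<le> t 0 \<and> (\<forall>k\<le>n. t k < t (Suc k)) \<and>
        \<P>(\<omega> in M. \<forall>k\<le>n. X (t k) \<omega> = x k) > 0 \<longrightarrow>
        \<P>(\<omega> in M. X (t (Suc n)) \<omega> = x (Suc n) \<bar> \<forall>k\<le>n. X (t k) \<omega> = x k)
          = pmf (p (t (Suc n) - t n) (x n)) (x (Suc n)))"

definition skeleton :: "real \<Rightarrow> nat \<Rightarrow> 'a \<Rightarrow> 's list" where
  "skeleton \<delta> n \<omega> = map (\<lambda>k. X (real k * \<delta>) \<omega>) [0..<Suc n]"

lemma skeleton_eq_iff:
  "skeleton \<delta> n \<omega> = l \<longleftrightarrow> length l = Suc n \<and> (\<forall>k\<le>n. X (real k * \<delta>) \<omega> = l ! k)"
  by (auto simp: skeleton_def list_eq_iff_nth_eq less_Suc_eq_le simp del: upt_Suc)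

lemma sets_state [measurable]: "0 \<le> t \<Longrightarrow> {\<omega> \<in> space M. X t \<omega> = x} \<in> sets M"
  using measurable_sets[OF random_variable, of t "{x}"] by (simp add: vimage_def Int_def conj_commute)

lemma measurable_skeleton:
  assumes "0 \<le> \<delta>"
  shows "skeleton \<delta> n \<in> M \<rightarrow>\<^sub>M count_space UNIV"
  unfolding measurable_count_space_eq2_countable
proof (intro conjI ballI)
  fix l :: "'s list"
  have "skeleton \<delta> n -` {l} \<inter> space M
      = {\<omega> \<in> space M. length l = Suc n \<and> (\<forall>k\<in>{..n}. X (real k * \<delta>) \<omega> = l ! k)}"
    by (rule set_eqI, unfold Int_iff vimage_eq singleton_iff skeleton_eq_iff) auto
  also have "\<dots> \<in> sets M"
    using assms by (intro sets.sets_Collect sets.sets_Collect_finite_All sets_state) auto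
  finally show "skeleton \<delta> n -` {l} \<inter> space M \<in> sets M" .
qed auto

lemma sets_skeleton_eq: "0 \<le> \<delta> \<Longrightarrow> {\<omega> \<in> space M. skeleton \<delta> n \<omega> = l} \<in> sets M"
  using measurable_sets[OF measurable_skeleton, of \<delta> "{l}" n]
  by (simp add: vimage_def Int_def conj_commute)

text \<open>Induction on \<open>n\<close>: the Markov property, conditioned on the entire observed
  past, supplies the last factor.\<close>

lemma prob_skeleton_eq:
  assumes p: "markov_semigroup p" and "0 < \<delta>" and start: "AE \<omega> in M. X 0 \<omega> = x"
  shows "\<P>(\<omega> in M. skeleton \<delta> n \<omega> = l) = pmf (path_pmf (p \<delta>) x n) l"
proof (induction n arbitrary: l)
  case 0
  have "\<P>(\<omega> in M. skeleton \<delta> 0 \<omega> = l) = \<P>(\<omega> in M. [x] = l)"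
    using start \<open>0 < \<delta>\<close>
    by (intro finite_measure_eq_AE sets_skeleton_eq) (auto simp: skeleton_def)
  then show ?case by (cases "l = [x]") (auto simp: prob_space)
next
  case (Suc n)
  have skeleton_Suc: "skeleton \<delta> (Suc n) \<omega> = skeleton \<delta> n \<omega> @ [X (real (Suc n) * \<delta>) \<omega>]" for \<omega>
    by (simp add: skeleton_def)
  show ?case
  proof (cases l rule: rev_cases)
    case Nil
    then show ?thesis
      by (auto simp: skeleton_Suc pmf_eq_0_set_pmf dest: path_pmf_nonempty)
  next
    case (snoc l' j)
    define y where "y k = (l' @ [j]) ! k" for k
    have "\<P>(\<omega> in M. X (real (Suc n) * \<delta>) \<omega> = j \<and> skeleton \<delta> n \<omega> = l')
        = \<P>(\<omega> in M. skeleton \<delta> n \<omega> = l') * pmf (p \<delta> (last l')) j"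
    \<comment> \<open>The Markov property speaks only of histories of positive probability; for a
      null history both sides are \<open>0\<close>.\<close>
    proof (cases "\<P>(\<omega> in M. skeleton \<delta> n \<omega> = l') = 0")
      case True
      have "\<P>(\<omega> in M. X (real (Suc n) * \<delta>) \<omega> = j \<and> skeleton \<delta> n \<omega> = l')
          \<le> \<P>(\<omega> in M. skeleton \<delta> n \<omega> = l')"
        using \<open>0 < \<delta>\<close> by (intro finite_measure_mono sets_skeleton_eq) auto
      with True show ?thesis by (simp add: measure_le_0_iff)
    next
      case False
      then have pos: "\<P>(\<omega> in M. skeleton \<delta> n \<omega> = l') > 0"
        by (simp add: zero_less_measure_iff)
      have len: "length l' = Suc n"
      proof (rule ccontr)
        assume "length l' \<noteq> Suc n"
        then have "{\<omega> \<in> space M. skeleton \<delta> n \<omega> = l'} = {}" by (auto simp: skeleton_eq_iff)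
        with False show False by simp
      qed
      have hist: "(\<forall>k\<le>n. X (real k * \<delta>) \<omega> = y k) \<longleftrightarrow> skeleton \<delta> n \<omega> = l'" for \<omega>
        by (auto simp: skeleton_eq_iff y_def len nth_append)
      have "y n = last l'"
        using len by (cases l' rule: rev_cases) (auto simp: y_def nth_append)
      moreover have "y (Suc n) = j" using len by (simp add: y_def nth_append)
      moreover have "\<P>(\<omega> in M. X (real (Suc n) * \<delta>) \<omega> = y (Suc n) \<bar> \<forall>k\<le>n. X (real k * \<delta>) \<omega> = y k)
          = pmf (p (real (Suc n) * \<delta> - real n * \<delta>) (y n)) (y (Suc n))"
        using p[unfolded markov_semigroup_def, rule_format, of "\<lambda>k. real k * \<delta>" n y] pos \<open>0 < \<delta>\<close>
        by (simp add: hist)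
      moreover have "real (Suc n) * \<delta> - real n * \<delta> = \<delta>" by (simp add: algebra_simps)
      ultimately have "\<P>(\<omega> in M. X (real (Suc n) * \<delta>) \<omega> = j \<and> skeleton \<delta> n \<omega> = l')
          / \<P>(\<omega> in M. skeleton \<delta> n \<omega> = l') = pmf (p \<delta> (last l')) j"
        unfolding hist cond_prob_def by (simp only:)
      with pos show ?thesis
        by (simp add: nonzero_divide_eq_eq mult.commute)
    qed
    then show ?thesis
      unfolding snoc pmf_path_pmf_Suc Suc[symmetric] skeleton_Suc by (simp add: conj_commute)
  qed
qed

lemma prob_skeleton_visit:
  assumes p: "markov_semigroup p" and "0 < \<delta>" and start: "AE \<omega> in M. X 0 \<omega> = x"
  shows "\<P>(\<omega> in M. \<exists>k\<le>n. X (real k * \<delta>) \<omega> = z) = pmf (absorbed (p \<delta>) z x n) z"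
proof -
  note [measurable] = measurable_skeleton[OF less_imp_le[OF \<open>0 < \<delta>\<close>], of n]
  have "distr M (count_space UNIV) (skeleton \<delta> n) = measure_pmf (path_pmf (p \<delta>) x n)"
  proof (rule measure_eqI_countable)
    fix l :: "'s list"
    show "emeasure (distr M (count_space UNIV) (skeleton \<delta> n)) {l}
        = emeasure (measure_pmf (path_pmf (p \<delta>) x n)) {l}"
      using prob_skeleton_eq[OF assms, of n l]
      by (simp add: emeasure_distr emeasure_pmf_single emeasure_eq_measure vimage_def Int_def conj_commute)
  qed auto
  then have "pmf (absorbed (p \<delta>) z x n) z
      = measure (distr M (count_space UNIV) (skeleton \<delta> n)) {l. z \<in> set l}"
    by (simp add: measure_path_pmf_visit)
  also have "\<dots> = \<P>(\<omega> in M. z \<in> set (skeleton \<delta> n \<omega>))"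
    by (simp add: measure_distr vimage_def Int_def conj_commute)
  also have "\<dots> = \<P>(\<omega> in M. \<exists>k\<le>n. X (real k * \<delta>) \<omega> = z)"
    by (intro arg_cong[where f = prob]) (auto simp: skeleton_def less_Suc_eq_le simp del: upt_Suc)
  finally show ?thesis ..
qed

section \<open>Visits in continuous time as limits of visits on dyadic grids\<close>

lemma right_constant:
  assumes "\<omega> \<in> space M" "0 \<le> t"
  obtains b where "t < b" "\<And>s. t \<le> s \<Longrightarrow> s < b \<Longrightarrow> X s \<omega> = X t \<omega>"
proof -
  have "((\<lambda>s. X s \<omega>) \<longlongrightarrow> X t \<omega>) (at_right t)"
    using right_continuous[OF assms] by (simp add: continuous_within)
  then have "\<forall>\<^sub>F s in at_right t. X s \<omega> \<in> {X t \<omega>}"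
    by (rule topological_tendstoD) (rule Topological_Spaces.open_discrete, simp)
  then obtain b where b: "t < b" "\<And>s. t < s \<Longrightarrow> s < b \<Longrightarrow> X s \<omega> = X t \<omega>"
    by (auto simp: eventually_at_right_field)
  show ?thesis
    using b by (intro that[of b]) (auto simp: le_less)
qed

text \<open>Grids contain time \<open>0\<close> while the event asks for \<open>t > 0\<close>; a
  state occupied at \<open>s\<close> is still occupied slightly later.\<close>

lemma visit_pos:
  assumes "\<omega> \<in> space M" "0 \<le> s" "X s \<omega> = z"
  shows "\<exists>t>0. X t \<omega> = z"
proof -
  obtain b where b: "s < b" "\<And>t. s \<le> t \<Longrightarrow> t < b \<Longrightarrow> X t \<omega> = z"
    using right_constant[OF assms(1,2)] assms(3) by metis
  then show ?thesis
    using \<open>0 \<le> s\<close> by (intro exI[of _ "(s + b) / 2"]) auto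
qed

text \<open>A visit lasts for an interval \<open>[t, b)\<close>, which contains a point of every
  sufficiently fine grid. With \<open>4 ^ k\<close> steps of length \<open>1 / 2 ^ k\<close> the
  horizon \<open>2 ^ k\<close> eventually passes any \<open>t\<close>.\<close>

lemma visit_eq_dyadic_visit:
  "{\<omega> \<in> space M. \<exists>t>0. X t \<omega> = z} = (\<Union>k. {\<omega> \<in> space M. \<exists>m\<le>4^k. X (real m * (1 / 2^k)) \<omega> = z})"
proof (intro set_eqI iffI)
  fix \<omega> assume "\<omega> \<in> {\<omega> \<in> space M. \<exists>t>0. X t \<omega> = z}"
  then obtain t where \<omega>: "\<omega> \<in> space M" and t: "0 < t" "X t \<omega> = z" by auto
  obtain b where b: "t < b" "\<And>s. t \<le> s \<Longrightarrow> s < b \<Longrightarrow> X s \<omega> = z"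
    using right_constant[OF \<omega>, of t] t by auto
  have "\<forall>\<^sub>F k in sequentially. t + 1 < 2 ^ k" by real_asymp
  moreover have "\<forall>\<^sub>F k in sequentially. 1 / 2 ^ k < b - t" using b(1) by real_asymp
  ultimately have "\<forall>\<^sub>F k in sequentially. t + 1 < 2 ^ k \<and> 1 / 2 ^ k < b - t"
    by eventually_elim auto
  then obtain k :: nat where k: "t + 1 < 2 ^ k" "1 / 2 ^ k < b - t"
    by (auto simp: eventually_sequentially)
  \<comment> \<open>Rounding \<open>t\<close> up to the grid gives a point in
    \<open>[t, t + 1 / 2 ^ k)\<close>, which lies before \<open>b\<close>.\<close>
  define m where "m = nat \<lceil>t * 2 ^ k\<rceil>"
  have m: "t * 2 ^ k \<le> real m" "real m < t * 2 ^ k + 1"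
    using t ceiling_correct[of "t * 2 ^ k"] by (auto simp: m_def)
  have "real m \<le> (t + 1) * 2 ^ k"
    using m(2) one_le_power[of "2::real" k] unfolding distrib_right by linarith
  also have "\<dots> \<le> 2 ^ k * 2 ^ k" using k(1) by (intro mult_right_mono) auto
  also have "\<dots> = real (4 ^ k)" by (simp flip: power_mult_distrib)
  finally have "m \<le> 4 ^ k" by (simp only: of_nat_le_iff)
  moreover have "t \<le> real m * (1 / 2 ^ k)" using m(1) by (simp add: field_simps)
  moreover have "real m * (1 / 2 ^ k) < b"
  proof -
    have "real m * (1 / 2 ^ k) < (t * 2 ^ k + 1) * (1 / 2 ^ k)"
      using m(2) by (intro mult_strict_right_mono) auto
    also have "\<dots> = t + 1 / 2 ^ k" by (simp add: field_simps)
    finally show ?thesis using k(2) by simp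
  qed
  ultimately show "\<omega> \<in> (\<Union>k. {\<omega> \<in> space M. \<exists>m\<le>4^k. X (real m * (1 / 2^k)) \<omega> = z})"
    using \<omega> b(2) by blast
next
  fix \<omega> assume "\<omega> \<in> (\<Union>k. {\<omega> \<in> space M. \<exists>m\<le>4^k. X (real m * (1 / 2^k)) \<omega> = z})"
  then obtain k m where \<omega>: "\<omega> \<in> space M" and z: "X (real (m :: nat) * (1 / 2^k)) \<omega> = z" by blast
  show "\<omega> \<in> {\<omega> \<in> space M. \<exists>t>0. X t \<omega> = z}"
    using \<omega> visit_pos[OF \<omega> _ z] by simp
qed

lemma sets_dyadic_visit:
  "{\<omega> \<in> space M. \<exists>m\<le>n. X (real m * (1 / 2^k)) \<omega> = z} \<in> sets M"
proof -
  have "{\<omega> \<in> space M. \<exists>m\<in>{..n}. X (real m * (1 / 2^k)) \<omega> = z} \<in> sets M"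
    by (intro sets.sets_Collect_finite_Ex sets_state) auto
  then show ?thesis by (simp add: Bex_def)
qed

text \<open>The number of steps \<open>n\<close> is arbitrary here because
  \<open>absorbed_ge\<close> asks for one bound valid for all \<open>n\<close>.\<close>

lemma dyadic_visit_prob_le:
  "\<P>(\<omega> in M. \<exists>m\<le>n. X (real m * (1 / 2^k)) \<omega> = z) \<le> \<P>(\<omega> in M. \<exists>t>0. X t \<omega> = z)"
proof (rule finite_measure_mono)
  show "{\<omega> \<in> space M. \<exists>t>0. X t \<omega> = z} \<in> sets M"
    unfolding visit_eq_dyadic_visit using sets_dyadic_visit by blast
  show "{\<omega> \<in> space M. \<exists>m\<le>n. X (real m * (1 / 2^k)) \<omega> = z} \<subseteq> {\<omega> \<in> space M. \<exists>t>0. X t \<omega> = z}"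
  proof
    fix \<omega> assume "\<omega> \<in> {\<omega> \<in> space M. \<exists>m\<le>n. X (real m * (1 / 2^k)) \<omega> = z}"
    then obtain m where "\<omega> \<in> space M" "X (real m * (1 / 2^k)) \<omega> = z" by blast
    then show "\<omega> \<in> {\<omega> \<in> space M. \<exists>t>0. X t \<omega> = z}"
      using visit_pos[of \<omega> "real m * (1 / 2^k)" z] by simp
  qed
qed

lemma dyadic_visit_prob_tendsto:
  "(\<lambda>k. \<P>(\<omega> in M. \<exists>m\<le>4^k. X (real m * (1 / 2^k)) \<omega> = z)) \<longlonglongrightarrow> \<P>(\<omega> in M. \<exists>t>0. X t \<omega> = z)"
  unfolding visit_eq_dyadic_visit
proof (rule finite_Lim_measure_incseq)
  show "range (\<lambda>k. {\<omega> \<in> space M. \<exists>m\<le>4^k. X (real m * (1 / 2^k)) \<omega> = z}) \<subseteq> sets M"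
    using sets_dyadic_visit by blast
  show "incseq (\<lambda>k. {\<omega> \<in> space M. \<exists>m\<le>4^k. X (real m * (1 / 2^k)) \<omega> = z})"
  proof (rule incseq_SucI, safe)
    fix k m assume "m \<le> (4::nat) ^ k"
    then show "\<exists>m'\<le>4 ^ Suc k. X (real m' * (1 / 2 ^ Suc k)) \<omega> = X (real m * (1 / 2 ^ k)) \<omega>" for \<omega>
      \<comment> \<open>Each grid point is the point of doubled index on the next grid, and
        \<open>2 * 4 ^ k \<le> 4 ^ Suc k\<close>.\<close>
      by (intro exI[of _ "2 * m"]) simp
  qed
qed

end

subsection \<open>The probability that a busy period ends\<close>

theorem theorem2p5:
  fixes M :: "'a measure" and N :: "real \<Rightarrow> 'a \<Rightarrow> nat" and lam \<mu> :: real
  assumes "0 < \<mu>" and "\<mu> < lam"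
    and "ctmc M N (mm1_rate lam \<mu>)"
    and "AE \<omega> in M. N 0 \<omega> = 1"
  shows "\<P>(\<omega> in M. \<exists>t>0. N t \<omega> = 0) = \<mu> / lam"
proof -
  interpret ctmc M N "mm1_rate lam \<mu>" by fact
  obtain p where p: "transition_semigroup p" "has_jump_rates p (mm1_rate lam \<mu>)" "markov_semigroup p"
    using markov by (auto simp: markov_semigroup_def)
  interpret mm1_semigroup p lam \<mu>
    using p assms by unfold_locales
  define a where "a = \<P>(\<omega> in M. \<exists>t>0. N t \<omega> = 0)"
  have visit: "\<P>(\<omega> in M. \<exists>m\<le>n. N (real m * (1 / 2^k)) \<omega> = 0)
      = pmf (absorbed (p (1 / 2^k)) 0 1 n) 0" for n k
    by (intro prob_skeleton_visit p assms) simp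
  have "a \<le> \<mu> / lam"
  proof (rule LIMSEQ_le_const2)
    show "(\<lambda>k. pmf (absorbed (p (1 / 2^k)) 0 1 (4^k)) 0) \<longlonglongrightarrow> a"
      using dyadic_visit_prob_tendsto[of 0] unfolding visit a_def .
    show "\<exists>k. \<forall>n\<ge>k. pmf (absorbed (p (1 / 2^n)) 0 1 (4^n)) 0 \<le> \<mu> / lam"
      by (intro exI allI impI absorbed_le) simp
  qed
  \<comment> \<open>For fixed \<open>r\<close> the constant \<open>K\<close> is independent of the
    mesh, so letting the mesh tend to \<open>0\<close> removes the factor
    \<open>1 + K * \<delta>\<close>; only afterwards does \<open>r\<close> approach
    \<open>\<mu> / lam\<close>.\<close>
  moreover have "r \<le> a" if r: "0 < r" "r < \<mu> / lam" for r
  proof -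
    obtain K where K: "\<And>\<delta> b. 0 < \<delta> \<Longrightarrow> (lam + \<mu>) * \<delta> \<le> 1 / 2 \<Longrightarrow>
        (\<And>n. pmf (absorbed (p \<delta>) 0 1 n) 0 \<le> b) \<Longrightarrow> r \<le> (1 + K * \<delta>) * b"
      using absorbed_ge[OF r] by blast
    have lim: "(\<lambda>k. 1 / 2^k :: real) \<longlonglongrightarrow> 0"
      by real_asymp
    have "(\<lambda>k. (lam + \<mu>) * (1 / 2^k)) \<longlonglongrightarrow> 0"
      using tendsto_mult[OF tendsto_const lim, of "lam + \<mu>"] by simp
    then have "\<forall>\<^sub>F k in sequentially. (lam + \<mu>) * (1 / 2^k) < 1 / 2"
      by (rule order_tendstoD) simp
    then have "\<forall>\<^sub>F k in sequentially. r \<le> (1 + K * (1 / 2^k)) * a"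
    proof eventually_elim
      case (elim k)
      show ?case
      proof (rule K)
        show "pmf (absorbed (p (1 / 2^k)) 0 1 n) 0 \<le> a" for n
          using dyadic_visit_prob_le[of n k 0] unfolding visit a_def .
      qed (use elim in auto)
    qed
    moreover have "(\<lambda>k. (1 + K * (1 / 2^k)) * a) \<longlonglongrightarrow> a"
      using tendsto_mult[OF tendsto_add[OF tendsto_const[of 1] tendsto_mult[OF tendsto_const[of K] lim]]
          tendsto_const[of a]] by simp
    ultimately show ?thesis
      by (metis tendsto_lowerbound sequentially_bot)
  qed
  then have "\<mu> / lam \<le> a"
    by (rule dense_le_bounded[of 0, rotated]) (use assms in \<open>auto intro: divide_pos_pos\<close>)
  ultimately show ?thesis by (simp add: a_def)
qed

end
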